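(* Let $\boldsymbol{d}=\boldsymbol{d}(n)=(d_1,\ldots,d_n)$ be a degree sequence and $C=C(n)>0$ be such that $d_{\mathrm{min}}\ge 24+32C$ and $d_{\mathrm{max}}^2\le C\bar d n$, where $d_{\mathrm{min}}$, $d_{\mathrm{max}}$ and $\bar d$ are the minimum, maximum and average degrees of $\boldsymbol{d}$. Define $\alpha:=\frac{1}{6+8C}$. If $G$ is a uniformly random simple graph with $n$ vertices and degree sequence $\boldsymbol{d}$, then \[ \Pr\bigl( h(G) \ge \alpha d_{\mathrm{min}}\bigr) \ge 1 - \Bigl(\frac{d_{\mathrm{min}}^2}{5\bar d n}\Bigr)^{\frac{5}{26}\alpha d_{\mathrm{min}}^2}. \]
   Context: For a graph $G$, the isoperimetric number (Cheeger constant) is $h(G):=\min\bigl\{ |\partial_G U|/|U| : U\subset V(G),\ 1\le |U|\le \tfrac12|V(G)|\bigr\}$, where $\partial_G U$ is the set of edges of $G$ with one end in $U$ and the other end in $V(G)\setminus U$. *)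

theory Defs
  imports "HOL-Probability.Probability" "HOL-Library.Ramsey"
begin

text \<open>A simple graph on the finite vertex set \<open>V\<close> is given by its edge set, a set of
  two-element subsets of \<open>V\<close>.\<close>

definition simple_graph :: "'a set \<Rightarrow> 'a set set \<Rightarrow> bool" where
  "simple_graph V E \<longleftrightarrow> finite V \<and> E \<subseteq> nsets V 2"

definition vertex_degree :: "'a set set \<Rightarrow> 'a \<Rightarrow> nat" where
  "vertex_degree E v = card {e \<in> E. v \<in> e}"

definition edge_boundary :: "'a set \<Rightarrow> 'a set set \<Rightarrow> 'a set \<Rightarrow> 'a set set" where
  "edge_boundary V E U = {e \<in> E. \<exists>x\<in>U. \<exists>y\<in>V - U. e = {x, y}}"

text \<open>The minimum is over a finite set, nonempty as soon as \<open>V\<close> is finite with at least two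
  elements; for smaller \<open>V\<close> the value is unspecified.\<close>

definition isoperimetric_number :: "'a set \<Rightarrow> 'a set set \<Rightarrow> real" where
  "isoperimetric_number V E =
     Min {real (card (edge_boundary V E U)) / real (card U) | U.
            U \<subseteq> V \<and> 1 \<le> card U \<and> real (card U) \<le> real (card V) / 2}"

text \<open>A degree sequence \<open>(d\<^sub>1, \<dots>, d\<^sub>n)\<close> is a function on \<open>nat\<close> of which only the values
  on \<open>{1..n}\<close> matter; the vertex set is \<open>{1..n}\<close>.\<close>

definition graphs_with_degrees :: "nat \<Rightarrow> (nat \<Rightarrow> nat) \<Rightarrow> nat set set set" where
  "graphs_with_degrees n d =
     {E. simple_graph {1..n} E \<and> (\<forall>i\<in>{1..n}. vertex_degree E i = d i)}"

definition is_degree_sequence :: "nat \<Rightarrow> (nat \<Rightarrow> nat) \<Rightarrow> bool" where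
  "is_degree_sequence n d \<longleftrightarrow> graphs_with_degrees n d \<noteq> {}"

definition min_degree :: "nat \<Rightarrow> (nat \<Rightarrow> nat) \<Rightarrow> nat" where
  "min_degree n d = Min (d ` {1..n})"

definition max_degree :: "nat \<Rightarrow> (nat \<Rightarrow> nat) \<Rightarrow> nat" where
  "max_degree n d = Max (d ` {1..n})"

definition avg_degree :: "nat \<Rightarrow> (nat \<Rightarrow> nat) \<Rightarrow> real" where
  "avg_degree n d = (\<Sum>i = 1..n. real (d i)) / real n"

text \<open>\<open>pmf_of_set\<close> is the uniform distribution only on a finite nonempty set: the set of graphs is
  always finite, and it is nonempty exactly when \<open>is_degree_sequence n d\<close> holds.\<close>

definition random_graph :: "nat \<Rightarrow> (nat \<Rightarrow> nat) \<Rightarrow> nat set set pmf" where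
  "random_graph n d = pmf_of_set (graphs_with_degrees n d)"

end

theory Submission
  imports Defs
begin

text \<open>
  Write \<open>M\<close> for the degree sum and \<open>\<delta>\<close>, \<open>\<Delta>\<close> for the extreme degrees. If \<open>h(G) < \<alpha> \<delta>\<close>, then some set
  \<open>U\<close>, or else its complement, is a set \<open>W\<close> of degree sum \<open>s \<le> M / 2\<close> with
  \<open>|\<partial>W| < K\<close>, where \<open>K = \<alpha> \<delta> |W|\<close>; counting edges inside \<open>W\<close> forces \<open>|W| \<ge> 5 \<delta> / 6 + 1\<close>.

  For a fixed \<open>W\<close>, replace an edge \<open>ab\<close> inside \<open>W\<close> and an edge \<open>ce\<close> outside \<open>W\<close> by \<open>ac\<close> and \<open>be\<close>.
  This raises \<open>|\<partial>W|\<close> from \<open>k\<close> to \<open>k + 2\<close>, is possible in at least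
  \<open>(s - k) (M - s - k) - 2 k \<Delta>\<^sup>2\<close> ways, and at most \<open>(k + 2) (k + 1)\<close> switchings lead to a given graph.
  Iterating about \<open>K / 2\<close> times, that is until \<open>|\<partial>W|\<close> is about \<open>2 K\<close>, yields
  \<open>Pr(|\<partial>W| < K) \<le> (t / 4) powr (K / 2)\<close> with \<open>t = \<delta> |W| / M\<close>. A union bound over \<open>W\<close>, using
  \<open>n choose w \<le> (e / t) ^ w\<close>, leaves a sum over \<open>w\<close> dominated by a geometric series.
\<close>

subsection \<open>Arcs, degrees and edge boundaries\<close>

text \<open>Edges are counted as ordered pairs: \<open>arcs E W W\<close> meets every inner edge
  twice, once from each end, so that it adds up with degrees, while \<open>arcs E W (V - W)\<close>
  meets every boundary edge once.\<close>

definition arcs :: "'a set set \<Rightarrow> 'a set \<Rightarrow> 'a set \<Rightarrow> ('a \<times> 'a) set" where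
  "arcs E A B = {(x, y). x \<in> A \<and> y \<in> B \<and> {x, y} \<in> E}"

lemma arcs_eq_Sigma: "arcs E A B = (SIGMA x:A. {y \<in> B. {x, y} \<in> E})"
  by (auto simp: arcs_def)

lemma finite_arcs [simp]: "finite A \<Longrightarrow> finite B \<Longrightarrow> finite (arcs E A B)"
  by (auto simp: arcs_eq_Sigma)

lemma simple_graph_edgeD: "simple_graph V E \<Longrightarrow> {x, y} \<in> E \<Longrightarrow> x \<in> V \<and> y \<in> V \<and> x \<noteq> y"
  using doubleton_in_nsets_2[of x y V] by (auto simp: simple_graph_def simp del: doubleton_in_nsets_2)

lemma simple_graph_edge_cases:
  assumes "simple_graph V E" "e \<in> E" "v \<in> e"
  obtains y where "e = {v, y}"
proof -
  have "card e = 2" using assms by (auto simp: simple_graph_def nsets_def)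
  then obtain x y where "e = {x, y}" by (meson card_2_iff)
  then show ?thesis using assms(3) that[of x] that[of y] by (auto simp: insert_commute)
qed

lemma vertex_degree_eq_card_neighbours:
  assumes "simple_graph V E"
  shows "vertex_degree E v = card {y \<in> V. {v, y} \<in> E}"
proof -
  have "bij_betw (\<lambda>y. {v, y}) {y \<in> V. {v, y} \<in> E} {e \<in> E. v \<in> e}"
    unfolding bij_betw_def
  proof
    show "inj_on (\<lambda>y. {v, y}) {y \<in> V. {v, y} \<in> E}"
      by (auto simp: inj_on_def doubleton_eq_iff)
    show "(\<lambda>y. {v, y}) ` {y \<in> V. {v, y} \<in> E} = {e \<in> E. v \<in> e}"
    proof (intro equalityI subsetI)
      fix e assume e: "e \<in> {e \<in> E. v \<in> e}"
      then obtain y where "e = {v, y}" using simple_graph_edge_cases[OF assms, of e v] by auto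
      moreover then have "y \<in> V" using e simple_graph_edgeD[OF assms, of v y] by auto
      ultimately show "e \<in> (\<lambda>y. {v, y}) ` {y \<in> V. {v, y} \<in> E}" using e by auto
    qed auto
  qed
  then show ?thesis by (simp add: vertex_degree_def bij_betw_same_card)
qed

lemma card_edge_boundary_eq_arcs:
  "card (edge_boundary V E W) = card (arcs E W (V - W))"
proof -
  have "bij_betw (\<lambda>(x, y). {x, y}) (arcs E W (V - W)) (edge_boundary V E W)"
    unfolding bij_betw_def
  proof
    show "inj_on (\<lambda>(x, y). {x, y}) (arcs E W (V - W))"
      by (auto simp: inj_on_def arcs_def doubleton_eq_iff)
    show "(\<lambda>(x, y). {x, y}) ` arcs E W (V - W) = edge_boundary V E W"
    proof (intro equalityI subsetI)
      fix e assume "e \<in> edge_boundary V E W"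
      then obtain x y where "e \<in> E" "x \<in> W" "y \<in> V - W" "e = {x, y}"
        unfolding edge_boundary_def by blast
      then show "e \<in> (\<lambda>(x, y). {x, y}) ` arcs E W (V - W)"
        by (intro image_eqI[of _ _ "(x, y)"]) (simp_all add: arcs_def)
    next
      fix e assume "e \<in> (\<lambda>(x, y). {x, y}) ` arcs E W (V - W)"
      then obtain x y where "x \<in> W" "y \<in> V - W" "{x, y} \<in> E" "e = {x, y}"
        by (clarsimp simp: arcs_def)
      then show "e \<in> edge_boundary V E W" unfolding edge_boundary_def by blast
    qed
  qed
  then show ?thesis by (simp add: bij_betw_same_card)
qed

lemma edge_boundary_complement:
  assumes "W \<subseteq> V"
  shows "edge_boundary V E (V - W) = edge_boundary V E W"
proof -
  have "V - (V - W) = W" using assms by auto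
  then show ?thesis by (auto simp: edge_boundary_def insert_commute)
qed

lemma card_arcs_add_boundary:
  assumes G: "simple_graph V E" and W: "W \<subseteq> V"
  shows "card (arcs E W W) + card (edge_boundary V E W) = (\<Sum>v\<in>W. vertex_degree E v)"
proof -
  have fin: "finite V" "finite W" using G W by (auto simp: simple_graph_def finite_subset)
  have "card (arcs E W W) + card (arcs E W (V - W)) =
      (\<Sum>v\<in>W. card {y \<in> W. {v, y} \<in> E} + card {y \<in> V - W. {v, y} \<in> E})"
    using fin by (simp add: arcs_eq_Sigma sum.distrib)
  also have "\<dots> = (\<Sum>v\<in>W. vertex_degree E v)"
  proof (rule sum.cong[OF refl])
    fix v
    have "card {y \<in> W. {v, y} \<in> E} + card {y \<in> V - W. {v, y} \<in> E} =
        card ({y \<in> W. {v, y} \<in> E} \<union> {y \<in> V - W. {v, y} \<in> E})"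
      using fin by (intro card_Un_disjoint[symmetric]) auto
    also have "{y \<in> W. {v, y} \<in> E} \<union> {y \<in> V - W. {v, y} \<in> E} = {y \<in> V. {v, y} \<in> E}"
      using W by auto
    finally show "card {y \<in> W. {v, y} \<in> E} + card {y \<in> V - W. {v, y} \<in> E} = vertex_degree E v"
      by (simp add: vertex_degree_eq_card_neighbours[OF G])
  qed
  finally show ?thesis by (simp add: card_edge_boundary_eq_arcs)
qed

text \<open>\<open>W\<close> spans at most \<open>card W * (card W - 1)\<close> arcs and fewer than
  \<open>c * card W\<close> edges leave it, yet its degrees sum to at least
  \<open>\<delta> * card W\<close>. Dividing by \<open>card W\<close> gives the bound.\<close>

lemma card_ge_of_small_boundary:
  assumes G: "simple_graph V E" and W: "W \<subseteq> V" and deg: "\<And>v. v \<in> V \<Longrightarrow> \<delta> \<le> vertex_degree E v"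
    and small: "real (card (edge_boundary V E W)) < c * real (card W)"
  shows "real (card W) > real \<delta> + 1 - c"
proof -
  have fin: "finite W" using G W by (auto simp: simple_graph_def finite_subset)
  have W0: "card W > 0"
    using small by (cases "card W = 0") auto
  have "arcs E W W \<subseteq> (SIGMA x:W. W - {x})"
    using simple_graph_edgeD[OF G] by (auto simp: arcs_def)
  then have "card (arcs E W W) \<le> card (SIGMA x:W. W - {x})"
    using fin by (intro card_mono) auto
  also have "\<dots> = card W * (card W - 1)" using fin by simp
  finally have 1: "real (card (arcs E W W)) \<le> real (card W) * (real (card W) - 1)"
    using W0 by (metis Suc_leI of_nat_1 of_nat_diff of_nat_le_iff of_nat_mult One_nat_def)
  have "card W * \<delta> \<le> (\<Sum>v\<in>W. vertex_degree E v)"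
    using sum_bounded_below[of W \<delta> "vertex_degree E"] deg W by auto
  then have "real (card W) * real \<delta> \<le> real (card (arcs E W W)) + real (card (edge_boundary V E W))"
    using card_arcs_add_boundary[OF G W] by (metis of_nat_add of_nat_le_iff of_nat_mult)
  with 1 small have "real (card W) * real \<delta> < real (card W) * (real (card W) - 1 + c)"
    by (simp add: algebra_simps)
  then show ?thesis using W0 by simp
qed

subsection \<open>Switchings\<close>

text \<open>For \<open>p = (a, b)\<close> and \<open>q = (c, e)\<close> the edges ab, ce become ac,
  be. Ordered pairs, rather than edges, fix which of the two possible reconnections is
  meant.\<close>

definition switch :: "'a set set \<Rightarrow> 'a \<times> 'a \<Rightarrow> 'a \<times> 'a \<Rightarrow> 'a set set" where
  "switch E p q = (E - {{fst p, snd p}, {fst q, snd q}}) \<union> {{fst p, fst q}, {snd p, snd q}}"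

text \<open>In its uses \<open>A = W\<close> and \<open>B = V - W\<close> are disjoint, which rules
  out loops; the only obstruction left is a new edge that is already present.\<close>

definition switchings :: "'a set set \<Rightarrow> 'a set \<Rightarrow> 'a set \<Rightarrow> (('a \<times> 'a) \<times> ('a \<times> 'a)) set" where
  "switchings E A B = {(p, q). p \<in> arcs E A A \<and> q \<in> arcs E B B \<and>
     {fst p, fst q} \<notin> E \<and> {snd p, snd q} \<notin> E}"

text \<open>The four ends are distinct, since a, b lie in \<open>W\<close> and c, e outside it. Each
  of them lies in exactly one removed and exactly one added edge.\<close>

lemma vertex_degree_switch:
  assumes G: "simple_graph V E" and sw: "(p, q) \<in> switchings E W (V - W)"
  shows "vertex_degree (switch E p q) v = vertex_degree E v"
proof -
  obtain a b c e where pq: "p = (a, b)" "q = (c, e)" by (metis surj_pair)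
  have E: "{a, b} \<in> E" "{c, e} \<in> E" "{a, c} \<notin> E" "{b, e} \<notin> E"
    and mem: "a \<in> W" "b \<in> W" "c \<notin> W" "e \<notin> W"
    using sw by (auto simp: pq switchings_def arcs_def)
  have ne: "a \<noteq> b" "c \<noteq> e" using E simple_graph_edgeD[OF G] by blast+
  have finE: "finite E" using G by (auto simp: simple_graph_def finite_imp_finite_nsets intro: finite_subset)
  let ?D = "{x \<in> {{a, b}, {c, e}}. v \<in> x}" and ?I = "{x \<in> {{a, c}, {b, e}}. v \<in> x}"
  let ?R = "{x \<in> E - {{a, b}, {c, e}}. v \<in> x}"
  have DI: "card ?D = card ?I"
  proof -
    have D: "?D = (if v = a \<or> v = b then {{a, b}} else if v = c \<or> v = e then {{c, e}} else {})"
      using mem by auto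
    have I: "?I = (if v = a \<or> v = c then {{a, c}} else if v = b \<or> v = e then {{b, e}} else {})"
      using mem ne by auto
    show ?thesis unfolding D I by auto
  qed
  have "{x \<in> E. v \<in> x} = ?R \<union> ?D" using E by auto
  moreover have "card (?R \<union> ?D) = card ?R + card ?D" using finE by (intro card_Un_disjoint) auto
  moreover have "{x \<in> switch E p q. v \<in> x} = ?R \<union> ?I" by (auto simp: switch_def pq)
  moreover have "card (?R \<union> ?I) = card ?R + card ?I" using finE E by (intro card_Un_disjoint) auto
  ultimately show ?thesis unfolding vertex_degree_def using DI by simp
qed

lemma simple_graph_switch:
  assumes G: "simple_graph V E" and W: "W \<subseteq> V" and sw: "(p, q) \<in> switchings E W (V - W)"
  shows "simple_graph V (switch E p q)"
proof -
  have "fst p \<in> W" "snd p \<in> W" "fst q \<in> V - W" "snd q \<in> V - W"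
    using sw by (auto simp: switchings_def arcs_def)
  then have "{fst p, fst q} \<in> nsets V 2" "{snd p, snd q} \<in> nsets V 2"
    unfolding doubleton_in_nsets_2 using W by auto
  then show ?thesis using G unfolding simple_graph_def switch_def by blast
qed

lemma switch_inverse:
  assumes sw: "(p, q) \<in> switchings E W (V - W)"
  shows "E = (switch E p q - {{fst p, fst q}, {snd p, snd q}}) \<union> {{fst p, snd p}, {fst q, snd q}}"
  using sw by (auto simp: switch_def switchings_def arcs_def doubleton_eq_iff)

lemma arcs_switch:
  assumes sw: "(p, q) \<in> switchings E W (V - W)"
  shows "arcs (switch E p q) W (V - W) =
    arcs E W (V - W) \<union> {(fst p, fst q), (snd p, snd q)}"
  using sw by (auto simp: switch_def switchings_def arcs_def doubleton_eq_iff)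

text \<open>The removed edges lie on one side of the cut and both added edges cross it; they are
  different because the ends of \<open>p\<close> are.\<close>

lemma card_boundary_switch:
  assumes G: "simple_graph V E" and W: "W \<subseteq> V" and sw: "(p, q) \<in> switchings E W (V - W)"
  shows "card (edge_boundary V (switch E p q) W) = card (edge_boundary V E W) + 2"
proof -
  have fin: "finite V" "finite W" using G W by (auto simp: simple_graph_def finite_subset)
  have "{fst p, snd p} \<in> E" using sw by (auto simp: switchings_def arcs_def)
  then have "fst p \<noteq> snd p" using simple_graph_edgeD[OF G] by blast
  then have "card {(fst p, fst q), (snd p, snd q)} = 2" by simp
  moreover have "card (arcs E W (V - W) \<union> {(fst p, fst q), (snd p, snd q)}) =
      card (arcs E W (V - W)) + card {(fst p, fst q), (snd p, snd q)}"
    using fin sw by (intro card_Un_disjoint) (auto simp: switchings_def arcs_eq_Sigma)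
  ultimately show ?thesis
    by (simp add: card_edge_boundary_eq_arcs arcs_switch[OF sw])
qed

text \<open>With \<open>s\<close> and \<open>s'\<close> the degree sums of the two sides, there are
  \<open>s - k\<close> arcs inside \<open>W\<close> and \<open>s' - k\<close> outside. A pair ((a,
  b), (c, e)) of them fails only if ac or be is already an edge. Such an edge is one of the
  \<open>k\<close> boundary edges, and each of its two ends has at most \<open>\<Delta>\<close>
  neighbours to serve as the remaining vertices.\<close>

lemma card_switchings_ge:
  assumes G: "simple_graph V E" and W: "W \<subseteq> V" and deg: "\<And>v. v \<in> V \<Longrightarrow> vertex_degree E v \<le> \<Delta>"
  defines "k \<equiv> real (card (edge_boundary V E W))"
  shows "(real (\<Sum>v\<in>W. vertex_degree E v) - k) * (real (\<Sum>v\<in>V - W. vertex_degree E v) - k) - 2 * k * real \<Delta> ^ 2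
    \<le> real (card (switchings E W (V - W)))"
proof -
  have fin: "finite V" "finite W" using G W by (auto simp: simple_graph_def finite_subset)
  let ?In = "arcs E W W" and ?Out = "arcs E (V - W) (V - W)"
  let ?nb = "\<lambda>v. {y \<in> V. {v, y} \<in> E}"
  \<comment> \<open>A boundary arc with a neighbour of each of its ends. The neighbours may lie
    anywhere in \<open>V\<close>, so one set covers both \<open>B1\<close> and \<open>B2\<close>,
    with the two arcs in exchanged roles.\<close>
  define Bad where "Bad = (SIGMA r:arcs E W (V - W). ?nb (fst r) \<times> ?nb (snd r))"
  define B1 where "B1 = {(p, q). p \<in> ?In \<and> q \<in> ?Out \<and> {fst p, fst q} \<in> E}"
  define B2 where "B2 = {(p, q). p \<in> ?In \<and> q \<in> ?Out \<and> {snd p, snd q} \<in> E}"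
  have finBad: "finite Bad" using fin by (auto simp: Bad_def)
  have "card (?nb x \<times> ?nb y) \<le> \<Delta> ^ 2" if "(x, y) \<in> arcs E W (V - W)" for x y
  proof -
    have "x \<in> V" "y \<in> V" using that W by (auto simp: arcs_def)
    then show ?thesis using deg[of x] deg[of y]
      by (simp add: vertex_degree_eq_card_neighbours[OF G] card_cartesian_product power2_eq_square mult_mono)
  qed
  then have "(\<Sum>r\<in>arcs E W (V - W). card (?nb (fst r) \<times> ?nb (snd r))) \<le>
      of_nat (card (arcs E W (V - W))) * \<Delta> ^ 2"
    by (intro sum_bounded_above) force
  then have "card Bad \<le> card (arcs E W (V - W)) * \<Delta> ^ 2"
    unfolding Bad_def using fin by (subst card_SigmaI) auto
  then have Bad: "real (card Bad) \<le> k * real \<Delta> ^ 2"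
    unfolding k_def card_edge_boundary_eq_arcs by (metis of_nat_le_iff of_nat_mult of_nat_power)
  have "card B1 \<le> card Bad"
  proof (rule surj_card_le[OF finBad])
    show "B1 \<subseteq> (\<lambda>((a, c), (b, e)). ((a, b), (c, e))) ` Bad"
    proof
      fix z assume "z \<in> B1"
      then obtain a b c e where "z = ((a, b), (c, e))" "((a, c), (b, e)) \<in> Bad"
        using W by (auto simp: B1_def Bad_def arcs_def)
      then show "z \<in> (\<lambda>((a, c), (b, e)). ((a, b), (c, e))) ` Bad" by (intro image_eqI) auto
    qed
  qed
  moreover have "card B2 \<le> card Bad"
  proof (rule surj_card_le[OF finBad])
    show "B2 \<subseteq> (\<lambda>((b, e), (a, c)). ((a, b), (c, e))) ` Bad"
    proof
      fix z assume "z \<in> B2"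
      then obtain a b c e where "z = ((a, b), (c, e))" "((b, e), (a, c)) \<in> Bad"
        using W by (auto simp: B2_def Bad_def arcs_def insert_commute)
      then show "z \<in> (\<lambda>((b, e), (a, c)). ((a, b), (c, e))) ` Bad" by (intro image_eqI) auto
    qed
  qed
  moreover have "card (?In \<times> ?Out) \<le> card (switchings E W (V - W) \<union> (B1 \<union> B2))"
  proof (rule card_mono)
    have "switchings E W (V - W) \<union> (B1 \<union> B2) \<subseteq> ?In \<times> ?Out"
      by (auto simp: switchings_def B1_def B2_def)
    then show "finite (switchings E W (V - W) \<union> (B1 \<union> B2))"
      by (rule finite_subset) (use fin in auto)
    show "?In \<times> ?Out \<subseteq> switchings E W (V - W) \<union> (B1 \<union> B2)"
      by (auto simp: switchings_def B1_def B2_def)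
  qed
  moreover have "card (switchings E W (V - W) \<union> (B1 \<union> B2)) \<le> card (switchings E W (V - W)) + (card B1 + card B2)"
    by (meson add_left_mono card_Un_le le_trans)
  ultimately have "card ?In * card ?Out \<le> card (switchings E W (V - W)) + 2 * card Bad"
    by (simp add: card_cartesian_product)
  then have "real (card ?In * card ?Out) \<le> real (card (switchings E W (V - W)) + 2 * card Bad)"
    by (simp only: of_nat_le_iff)
  then have main: "real (card ?In) * real (card ?Out) \<le> real (card (switchings E W (V - W))) + 2 * real (card Bad)"
    by (simp only: of_nat_add of_nat_mult of_nat_numeral)
  have "real (card ?In) + k = real (\<Sum>v\<in>W. vertex_degree E v)"
    using arg_cong[OF card_arcs_add_boundary[OF G W], of real] by (simp only: k_def of_nat_add)
  moreover have "real (card ?Out) + k = real (\<Sum>v\<in>V - W. vertex_degree E v)"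
    using arg_cong[OF card_arcs_add_boundary[OF G, of "V - W"], of real] edge_boundary_complement[OF W, of E]
    by (simp only: k_def of_nat_add Diff_subset)
  ultimately have "real (card ?In) = real (\<Sum>v\<in>W. vertex_degree E v) - k"
    "real (card ?Out) = real (\<Sum>v\<in>V - W. vertex_degree E v) - k"
    by linarith+
  then show ?thesis using main Bad by (simp only:)
qed

section \<open>Double counting switchings between graphs with boundary sizes \<open>k\<close> and
  \<open>k + 2\<close>\<close>

definition realizations :: "'a set \<Rightarrow> ('a \<Rightarrow> nat) \<Rightarrow> 'a set set set" where
  "realizations V d = {E. simple_graph V E \<and> (\<forall>v\<in>V. vertex_degree E v = d v)}"

definition cut_class :: "'a set \<Rightarrow> ('a \<Rightarrow> nat) \<Rightarrow> 'a set \<Rightarrow> nat \<Rightarrow> 'a set set set" where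
  "cut_class V d W k = {E \<in> realizations V d. card (edge_boundary V E W) = k}"

lemma finite_realizations: "finite V \<Longrightarrow> finite (realizations V d)"
  by (rule finite_subset[of _ "Pow (nsets V 2)"])
    (auto simp: realizations_def simple_graph_def finite_imp_finite_nsets)

lemma finite_cut_class: "finite V \<Longrightarrow> finite (cut_class V d W k)"
  by (simp add: cut_class_def finite_realizations)

lemma card_distinct_pairs:
  assumes "finite A"
  shows "card {(x, y). x \<in> A \<and> y \<in> A \<and> x \<noteq> y} = card A * (card A - 1)"
proof -
  have "{(x, y). x \<in> A \<and> y \<in> A \<and> x \<noteq> y} = (SIGMA x:A. A - {x})" by auto
  then show ?thesis using assms by simp
qed

text \<open>Pairs of a graph and a switching of it inject into pairs of a resulting graph and two
  distinct boundary arcs in order. Each resulting graph has \<open>(k + 2) * (k + 1)\<close> of the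
  latter.\<close>

lemma cut_class_step:
  assumes V: "finite V" and W: "W \<subseteq> V" and deg: "\<And>v. v \<in> V \<Longrightarrow> d v \<le> \<Delta>"
  shows "real (card (cut_class V d W k)) *
      ((real (\<Sum>v\<in>W. d v) - real k) * (real (\<Sum>v\<in>V - W. d v) - real k) - 2 * real k * real \<Delta> ^ 2)
    \<le> (real k + 2) * (real k + 1) * real (card (cut_class V d W (k + 2)))" (is "_ * ?F \<le> _")
proof -
  let ?Q = "\<lambda>E. {(r, r'). r \<in> arcs E W (V - W) \<and> r' \<in> arcs E W (V - W) \<and> r \<noteq> r'}"
  define S where "S = (SIGMA E:cut_class V d W k. switchings E W (V - W))"
  define T where "T = (SIGMA E:cut_class V d W (k + 2). ?Q E)"
  \<comment> \<open>The two new boundary arcs are recorded with the graph: they determine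
    \<open>p\<close> and \<open>q\<close>, and then \<open>switch_inverse\<close> recovers
    \<open>E\<close>.\<close>
  define f where "f = (\<lambda>(E, (p, q)). (switch E p q, ((fst p, fst q), (snd p, snd q)) :: ('a \<times> 'a) \<times> ('a \<times> 'a)))"
  have finW: "finite W" using V W finite_subset by blast
  have finsw: "finite (switchings E W (V - W))" for E
    by (rule finite_subset[of _ "arcs E W W \<times> arcs E (V - W) (V - W)"])
      (use V finW in \<open>auto simp: switchings_def\<close>)
  have finQ: "finite (?Q E)" for E
    by (rule finite_subset[of _ "arcs E W (V - W) \<times> arcs E W (V - W)"])
      (use V finW in auto)
  have finT: "finite T" unfolding T_def using finite_cut_class[OF V] finQ by blast
  have "inj_on f S"
  proof (rule inj_onI)
    fix z z' assume z: "z \<in> S" and z': "z' \<in> S" and eq: "f z = f z'"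
    obtain E p q where zz: "z = (E, (p, q))" by (metis surj_pair)
    obtain E' p' q' where zz': "z' = (E', (p', q'))" by (metis surj_pair)
    have pq: "p = p'" "q = q'" using eq by (auto simp: zz zz' f_def intro: prod_eqI)
    have sw: "(p, q) \<in> switchings E W (V - W)" "(p, q) \<in> switchings E' W (V - W)"
      using z z' by (simp_all add: S_def zz zz' pq)
    have "switch E p q = switch E' p q" using eq by (simp add: zz zz' f_def pq)
    then have "E = E'" using switch_inverse[OF sw(1)] switch_inverse[OF sw(2)] by simp
    then show "z = z'" using pq by (simp add: zz zz')
  qed
  moreover have "f ` S \<subseteq> T"
  proof
    fix y assume "y \<in> f ` S"
    then obtain E p q where y: "y = f (E, (p, q))" and E: "E \<in> cut_class V d W k"
      and sw: "(p, q) \<in> switchings E W (V - W)" by (auto simp: S_def)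
    have G: "simple_graph V E" and dE: "\<And>v. v \<in> V \<Longrightarrow> vertex_degree E v = d v"
      and kE: "card (edge_boundary V E W) = k"
      using E by (auto simp: cut_class_def realizations_def)
    have "switch E p q \<in> cut_class V d W (k + 2)"
      using simple_graph_switch[OF G W sw] vertex_degree_switch[OF G sw] dE
        card_boundary_switch[OF G W sw] kE
      by (simp add: cut_class_def realizations_def)
    moreover have "fst p \<noteq> snd p"
    proof -
      have "{fst p, snd p} \<in> E" using sw by (auto simp: switchings_def arcs_def)
      then show ?thesis using simple_graph_edgeD[OF G] by blast
    qed
    ultimately show "y \<in> T"
      by (simp add: y f_def T_def arcs_switch[OF sw])
  qed
  ultimately have ST: "card S \<le> card T" using finT card_inj_on_le by blast
  have "card (?Q E) = (k + 2) * (k + 1)" if "E \<in> cut_class V d W (k + 2)" for E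
  proof -
    have "card (arcs E W (V - W)) = k + 2"
      using that by (simp add: cut_class_def card_edge_boundary_eq_arcs)
    then show ?thesis
      by (subst card_distinct_pairs) (use V finW in auto)
  qed
  then have "card T = card (cut_class V d W (k + 2)) * ((k + 2) * (k + 1))"
    unfolding T_def using finite_cut_class[OF V] finQ by (subst card_SigmaI) auto
  then have T: "real (card T) = (real k + 2) * (real k + 1) * real (card (cut_class V d W (k + 2)))"
    by (simp add: algebra_simps)
  have "real (card (cut_class V d W k)) * ?F \<le> (\<Sum>E\<in>cut_class V d W k. real (card (switchings E W (V - W))))"
  proof (rule sum_bounded_below)
    fix E assume E: "E \<in> cut_class V d W k"
    have G: "simple_graph V E" and dE: "\<And>v. v \<in> V \<Longrightarrow> vertex_degree E v = d v"
      and kE: "card (edge_boundary V E W) = k"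
      using E by (auto simp: cut_class_def realizations_def)
    have sums: "(\<Sum>v\<in>W. vertex_degree E v) = (\<Sum>v\<in>W. d v)"
      "(\<Sum>v\<in>V - W. vertex_degree E v) = (\<Sum>v\<in>V - W. d v)"
      using dE W by (auto intro!: sum.cong)
    show "?F \<le> real (card (switchings E W (V - W)))"
      using card_switchings_ge[OF G W, of \<Delta>] deg dE by (simp only: sums kE)
  qed
  also have "\<dots> = real (card S)"
    unfolding S_def using finite_cut_class[OF V] finsw by (subst card_SigmaI) auto
  finally show ?thesis using ST T by linarith
qed

subsection \<open>The probability that a fixed set has a small boundary\<close>

lemma iterated_ratio_bound:
  fixes c :: "nat \<Rightarrow> real" and r :: "nat \<Rightarrow> real"
  assumes "\<And>i. i < j \<Longrightarrow> c (k + 2 * i) \<le> r i * c (k + 2 * i + 2)" "\<And>i. i < j \<Longrightarrow> 0 \<le> r i"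
  shows "c k \<le> (\<Prod>i<j. r i) * c (k + 2 * j)"
  using assms
proof (induction j)
  case (Suc j)
  have "c k \<le> (\<Prod>i<j. r i) * c (k + 2 * j)" using Suc by simp
  also have "\<dots> \<le> (\<Prod>i<j. r i) * (r j * c (k + 2 * j + 2))"
    using Suc.prems by (intro mult_left_mono prod_nonneg) auto
  finally show ?case by (simp add: mult.assoc)
qed simp

text \<open>Divided by \<open>s M \<alpha>\<^sup>2\<close>, the lower bound for \<open>F\<close> is smallest at \<open>\<alpha> = 1 / 6\<close> (that is, \<open>C = 0\<close>), where it
  equals \<open>(6 - x)\<^sup>2 / 2\<close>.\<close>

lemma switching_ratio_bound:
  fixes k x K D s M Q C \<alpha> :: real
  assumes C: "C > 0" and \<alpha>: "\<alpha> = 1 / (6 + 8 * C)" and x: "1 \<le> x" "x \<le> 2"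
    and k: "0 \<le> k" "k \<le> x * K" and K: "K = \<alpha> * D" "30 \<le> K"
    and s: "D \<le> s" "2 * s \<le> M" and Q: "Q \<le> C * M"
  defines "F \<equiv> (s - k) * (M - s - k) - 2 * k * Q"
  shows "F > 0" "(k + 2) * (k + 1) \<le> 9 / 4 * (D / M) * (x / (6 - x))\<^sup>2 * F"
proof -
  have a0: "\<alpha> > 0" and a6: "6 * \<alpha> \<le> 1" and Ca: "8 * (C * \<alpha>) = 1 - 6 * \<alpha>"
    using C by (auto simp: \<alpha> field_simps)
  have D0: "D > 0" using K a0 by (metis less_le_trans zero_less_mult_pos zero_less_numeral)
  have s0: "s > 0" and M0: "M > 0" using D0 s by auto
  have "K \<le> \<alpha> * s" using K s a0 by simp
  then have ks: "k \<le> x * (\<alpha> * s)" using k x by (meson mult_left_mono order_trans zero_le_one)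
  have xa: "x * \<alpha> < 1" using mult_right_mono[of x 2 \<alpha>] x a0 a6 by linarith
  have 1: "s * (1 - x * \<alpha>) \<le> s - k" using ks by (simp add: algebra_simps)
  have 2: "M / 2 * (1 - x * \<alpha>) \<le> M - s - k"
  proof -
    have "(1 + x * \<alpha>) * s \<le> (1 + x * \<alpha>) * (M / 2)" using s x a0 by (intro mult_left_mono) auto
    moreover have "(1 + x * \<alpha>) * s = s + x * (\<alpha> * s)" "(1 + x * \<alpha>) * (M / 2) = M - M / 2 * (1 - x * \<alpha>)"
      by (simp_all add: field_simps)
    ultimately show ?thesis using ks by linarith
  qed
  have "s * (1 - x * \<alpha>) * (M / 2 * (1 - x * \<alpha>)) \<le> (s - k) * (M - s - k)"
  proof (intro mult_mono[OF 1 2] order_trans[OF _ 1])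
    show "0 \<le> s * (1 - x * \<alpha>)" "0 \<le> M / 2 * (1 - x * \<alpha>)" using s0 M0 xa by simp_all
  qed
  moreover have "2 * k * Q \<le> 2 * (x * (\<alpha> * s)) * (C * M)"
  proof -
    have "2 * k * Q \<le> 2 * k * (C * M)" using k Q by (intro mult_left_mono) auto
    also have "\<dots> \<le> 2 * (x * (\<alpha> * s)) * (C * M)" using ks C M0 by (intro mult_right_mono) auto
    finally show ?thesis .
  qed
  ultimately have "F \<ge> s * (1 - x * \<alpha>) * (M / 2 * (1 - x * \<alpha>)) - 2 * (x * (\<alpha> * s)) * (C * M)"
    by (simp add: F_def)
  also have "s * (1 - x * \<alpha>) * (M / 2 * (1 - x * \<alpha>)) - 2 * (x * (\<alpha> * s)) * (C * M)
    = s * M * ((1 - x * \<alpha>)\<^sup>2 / 2 - x * (8 * (C * \<alpha>)) / 4)"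
    by (simp add: power2_eq_square algebra_simps)
  \<comment> \<open>Write \<open>1 - x * \<alpha>\<close> as
    \<open>(1 - 6 * \<alpha>) + \<alpha> * (6 - x)\<close> and expand the square. The surplus has
    the factor \<open>1 - 6 * \<alpha>\<close> and is nonnegative because
    \<open>6 * \<alpha> \<le> 1\<close> and \<open>x \<le> 2\<close>.\<close>
  also have "(1 - x * \<alpha>)\<^sup>2 / 2 - x * (8 * (C * \<alpha>)) / 4 =
     \<alpha>\<^sup>2 * (6 - x)\<^sup>2 / 2 + (1 - 6 * \<alpha>) / 2 * ((1 - x / 2) * (1 + 4 * \<alpha>) + 2 * \<alpha>)"
    unfolding Ca by (simp add: power2_eq_square field_simps)
  finally have F1: "s * M * (\<alpha>\<^sup>2 * (6 - x)\<^sup>2 / 2 + (1 - 6 * \<alpha>) / 2 * ((1 - x / 2) * (1 + 4 * \<alpha>) + 2 * \<alpha>)) \<le> F" .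
  have "0 \<le> (1 - 6 * \<alpha>) / 2 * ((1 - x / 2) * (1 + 4 * \<alpha>) + 2 * \<alpha>)"
    using a0 a6 x by (intro mult_nonneg_nonneg add_nonneg_nonneg) auto
  then have "s * M * (\<alpha>\<^sup>2 * (6 - x)\<^sup>2 / 2) \<le> s * M * (\<alpha>\<^sup>2 * (6 - x)\<^sup>2 / 2 + (1 - 6 * \<alpha>) / 2 * ((1 - x / 2) * (1 + 4 * \<alpha>) + 2 * \<alpha>))"
    using s0 M0 by (intro mult_left_mono) auto
  with F1 have F2: "s * M * (\<alpha>\<^sup>2 * (6 - x)\<^sup>2 / 2) \<le> F" by linarith
  have "0 < s * M * (\<alpha>\<^sup>2 * (6 - x)\<^sup>2 / 2)" using s0 M0 a0 x by simp
  with F2 show "F > 0" by linarith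
  define z where "z = x * K"
  have z: "30 \<le> z" using mult_mono[of 1 x 30 K] x K by (simp add: z_def)
  have "(k + 2) * (k + 1) \<le> (z + 2) * (z + 1)"
    using k z by (intro mult_mono) (auto simp: z_def)
  \<comment> \<open>This amounts to \<open>24 * z + 16 \<le> z * z\<close>; the assumption
    \<open>30 \<le> K\<close> guarantees it.\<close>
  also have "\<dots> \<le> 9 / 8 * z\<^sup>2"
  proof -
    have "30 * z \<le> z * z" using z by (intro mult_right_mono) auto
    then have "24 * z + 16 \<le> z * z" using z by linarith
    then show ?thesis by (simp add: power2_eq_square algebra_simps)
  qed
  also have "\<dots> = 9 / 8 * (x * \<alpha>)\<^sup>2 * (D * D)" by (simp add: z_def K power2_eq_square algebra_simps)
  \<comment> \<open>One factor \<open>D\<close> is traded for \<open>s\<close>, which cancels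
    against the \<open>s\<close> in the bound for \<open>F\<close> and leaves the ratio
    \<open>D / M\<close>.\<close>
  also have "\<dots> \<le> 9 / 8 * (x * \<alpha>)\<^sup>2 * (D * s)" using s D0 by (intro mult_left_mono) auto
  also have "\<dots> = 9 / 4 * (D / M) * (x / (6 - x))\<^sup>2 * (s * M * (\<alpha>\<^sup>2 * (6 - x)\<^sup>2 / 2))"
    using M0 x by (simp add: field_simps)
  also have "\<dots> \<le> 9 / 4 * (D / M) * (x / (6 - x))\<^sup>2 * F"
    using F2 D0 M0 by (intro mult_left_mono) auto
  finally show "(k + 2) * (k + 1) \<le> 9 / 4 * (D / M) * (x / (6 - x))\<^sup>2 * F" .
qed

text \<open>Pairing the factor \<open>i\<close> with \<open>j - 1 - i\<close>: if \<open>x + y \<le> 3\<close> then \<open>x y / ((6 - x) (6 - y)) \<le> 1 / 9\<close>.\<close>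

lemma paired_product_bound:
  fixes K :: real
  assumes K: "K > 0" "2 * (real j - 1) \<le> K"
  defines "x \<equiv> \<lambda>i. 1 + 2 * real i / K"
  shows "(\<Prod>i<j. x i / (6 - x i))\<^sup>2 \<le> (1 / 9) ^ j"
proof -
  have x1: "1 \<le> x i" for i using K by (simp add: x_def)
  have pair: "x i + x (j - Suc i) \<le> 3" if "i < j" for i
  proof -
    have "real i + real (j - Suc i) = real j - 1" using that by (simp add: of_nat_diff)
    then have "x i + x (j - Suc i) = 2 + 2 * (real j - 1) / K"
      by (simp add: x_def flip: add_divide_distrib distrib_left)
    then show ?thesis using K by (simp add: divide_le_eq_1)
  qed
  have prod: "0 \<le> x i / (6 - x i) \<and> x i / (6 - x i) * (x (j - Suc i) / (6 - x (j - Suc i))) \<le> 1 / 9" if "i < j" for i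
  proof -
    let ?y = "x (j - Suc i)"
    have y: "1 \<le> ?y" "x i + ?y \<le> 3" "1 \<le> x i" using x1 pair[OF that] by auto
    have "4 * (x i * ?y) \<le> (x i + ?y)\<^sup>2" using sum_squares_ge_zero[of "x i - ?y" 0]
      by (simp add: power2_eq_square algebra_simps)
    also have "\<dots> \<le> 3\<^sup>2" using y by (intro power_mono) auto
    \<comment> \<open>Expanded, the claim is \<open>8 * x * y + 6 * (x + y) \<le> 36\<close>; each
      summand on the left is at most 18, with equality at \<open>x = y = 3 / 2\<close>.\<close>
    finally have "9 * (x i * ?y) \<le> (6 - x i) * (6 - ?y)" using y by (simp add: algebra_simps)
    then show ?thesis using y by (simp add: divide_simps)
  qed
  have nn: "0 \<le> x i / (6 - x i)" if "i < j" for i using prod[OF that] by simp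
  \<comment> \<open>Squaring provides two copies of the product; reversing the order of the second
    one creates the pairs.\<close>
  have "(\<Prod>i<j. x i / (6 - x i))\<^sup>2 =
      (\<Prod>i<j. x i / (6 - x i)) * (\<Prod>i<j. x (j - Suc i) / (6 - x (j - Suc i)))"
    by (simp only: power2_eq_square prod.nat_diff_reindex[of "\<lambda>i. x i / (6 - x i)"])
  also have "\<dots> = (\<Prod>i<j. x i / (6 - x i) * (x (j - Suc i) / (6 - x (j - Suc i))))"
    by (simp only: prod.distrib)
  also have "\<dots> \<le> (\<Prod>i<j. 1 / 9)"
    by (intro prod_mono conjI mult_nonneg_nonneg nn prod[THEN conjunct2]) auto
  finally show ?thesis by simp
qed

text \<open>Every class with \<open>k < K\<close> is pushed up by \<open>2 * j\<close>. The ratios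
  \<open>r i\<close> do not depend on \<open>k\<close>, and the shifted classes are disjoint, so
  together they number at most all realizations.\<close>

lemma card_small_cut_le:
  fixes C \<alpha> :: real
  assumes V: "finite V" and W: "W \<subseteq> V"
    and deg: "\<And>v. v \<in> V \<Longrightarrow> \<delta> \<le> d v" "\<And>v. v \<in> V \<Longrightarrow> d v \<le> \<Delta>"
    and half: "2 * (\<Sum>v\<in>W. d v) \<le> (\<Sum>v\<in>V. d v)"
    and C: "C > 0" and \<alpha>: "\<alpha> = 1 / (6 + 8 * C)"
    and \<Delta>: "(real \<Delta>)\<^sup>2 \<le> C * real (\<Sum>v\<in>V. d v)"
  defines "K \<equiv> \<alpha> * real \<delta> * real (card W)"
    and "t \<equiv> real \<delta> * real (card W) / real (\<Sum>v\<in>V. d v)"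
  assumes K: "30 \<le> K"
  shows "real (card {E \<in> realizations V d. real (card (edge_boundary V E W)) < K})
    \<le> (t / 4) powr (K / 2) * real (card (realizations V d))"
proof -
  define D where "D = real \<delta> * real (card W)"
  define s where "s = real (\<Sum>v\<in>W. d v)"
  define M where "M = real (\<Sum>v\<in>V. d v)"
  \<comment> \<open>Rounding up gives \<open>K / 2 \<le> j\<close>, needed for the final exponent,
    while \<open>2 * (j - 1) < K\<close> keeps \<open>x i \<le> 2\<close> and allows the pairing of
    factors.\<close>
  define j where "j = nat \<lceil>K / 2\<rceil>"
  define x where "x = (\<lambda>i::nat. 1 + 2 * real i / K)"
  define r where "r = (\<lambda>i. 9 / 4 * (D / M) * (x i / (6 - x i))\<^sup>2)"
  define R where "R = (\<Prod>i<j. r i)"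
  let ?c = "\<lambda>k. real (card (cut_class V d W k))"
  let ?\<G> = "realizations V d"
  have KD: "K = \<alpha> * D" by (simp add: K_def D_def)
  have a0: "\<alpha> > 0" using C by (simp add: \<alpha>)
  have D0: "D > 0" using K KD a0 by (metis less_le_trans zero_less_mult_pos zero_less_numeral)
  have "card W * \<delta> \<le> (\<Sum>v\<in>W. d v)"
    using sum_bounded_below[of W \<delta> d] deg W by auto
  then have Ds: "D \<le> s" unfolding D_def s_def by (metis mult.commute of_nat_le_iff of_nat_mult)
  have sM: "2 * s \<le> M" using half unfolding s_def M_def by linarith
  have M0: "M > 0" using D0 Ds sM by linarith
  have outer: "real (\<Sum>v\<in>V - W. d v) = M - s"
  proof -
    have "(\<Sum>v\<in>V - W. d v) + (\<Sum>v\<in>W. d v) = (\<Sum>v\<in>V. d v)"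
      using sum.subset_diff[OF W V, of d] by simp
    then show ?thesis unfolding M_def s_def by linarith
  qed
  have tD: "t = D / M" by (simp add: t_def D_def M_def)
  have t: "0 < t" "t \<le> 1 / 2" using D0 M0 Ds sM by (auto simp: tD field_simps)
  have jK: "K / 2 \<le> real j" "2 * (real j - 1) < K" 
  proof -
    have "real j = of_int \<lceil>K / 2\<rceil>" using K unfolding j_def by simp
    then show "K / 2 \<le> real j" "2 * (real j - 1) < K" 
      using ceiling_correct[of "K / 2"] by auto
  qed
  have x12: "1 \<le> x i" "x i \<le> 2" if "i < j" for i
  proof -
    show "1 \<le> x i" using K by (simp add: x_def)
    have "real (Suc i) \<le> real j" using that by simp
    then have "2 * real i \<le> K" using jK by simp
    then show "x i \<le> 2" using K by (simp add: x_def divide_le_eq)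
  qed
  have r0: "0 \<le> r i" for i unfolding r_def using D0 M0 by simp
  \<comment> \<open>The factor \<open>9 / 4\<close> from each switching ratio meets
    \<open>1 / 9\<close> from the paired product, leaving \<open>1 / 4\<close>.\<close>
  have R: "R \<le> (t / 4) ^ j"
  proof -
    have "R = (9 / 4 * t) ^ j * (\<Prod>i<j. x i / (6 - x i))\<^sup>2"
      by (simp only: R_def r_def tD prod.distrib prod_constant card_lessThan prod_power_distrib power_mult_distrib)
    also have "\<dots> \<le> (9 / 4 * t) ^ j * (1 / 9) ^ j"
      using paired_product_bound[of K j] K jK t unfolding x_def by (intro mult_left_mono) auto
    also have "\<dots> = (t / 4) ^ j" by (simp flip: power_mult_distrib)
    finally show ?thesis .
  qed
  have R0: "0 \<le> R" unfolding R_def using r0 by (simp add: prod_nonneg)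
  have step: "?c (k + 2 * i) \<le> r i * ?c (k + 2 * i + 2)" if k: "real k < K" and i: "i < j" for k i
  proof -
    define k' where "k' = real (k + 2 * i)"
    define F where "F = (s - k') * (M - s - k') - 2 * k' * (real \<Delta>)\<^sup>2"
    have "x i * K = K + 2 * real i" using K by (simp add: x_def field_simps)
    then have k': "0 \<le> k'" "k' \<le> x i * K" using k by (auto simp: k'_def)
    have F0: "F > 0" and F: "(k' + 2) * (k' + 1) \<le> r i * F"
      using switching_ratio_bound[OF C \<alpha> x12[OF i] k' KD K Ds sM, of "(real \<Delta>)\<^sup>2"] \<Delta>
      by (auto simp: F_def r_def M_def)
    have "?c (k + 2 * i) * F \<le> (k' + 2) * (k' + 1) * ?c (k + 2 * i + 2)"
      using cut_class_step[of V W d \<Delta> "k + 2 * i", OF V W deg(2)]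
      unfolding outer F_def k'_def s_def[symmetric] by simp
    also have "\<dots> \<le> r i * F * ?c (k + 2 * i + 2)" using F by (intro mult_right_mono) auto
    finally show ?thesis using F0 by (simp add: mult.commute mult.left_commute)
  qed
  define I where "I = {k. real k < K}"
  have finI: "finite I" by (rule finite_subset[of _ "{..nat \<lceil>K\<rceil>}"]) (auto simp: I_def le_nat_iff, linarith)
  have "{E \<in> ?\<G>. real (card (edge_boundary V E W)) < K} = (\<Union>k\<in>I. cut_class V d W k)"
    by (auto simp: cut_class_def I_def)
  then have "real (card {E \<in> ?\<G>. real (card (edge_boundary V E W)) < K}) \<le> (\<Sum>k\<in>I. ?c k)"
    using card_UN_le[OF finI, of "cut_class V d W"] by (metis of_nat_le_iff of_nat_sum)
  also have "\<dots> \<le> (\<Sum>k\<in>I. R * ?c (k + 2 * j))"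
    unfolding R_def using step r0
    by (intro sum_mono iterated_ratio_bound) (auto simp: I_def)
  also have "\<dots> = R * real (\<Sum>k\<in>I. card (cut_class V d W (k + 2 * j)))"
    by (simp add: sum_distrib_left)
  also have "(\<Sum>k\<in>I. card (cut_class V d W (k + 2 * j))) = card (\<Union>k\<in>I. cut_class V d W (k + 2 * j))"
    using finI finite_cut_class[OF V]
    by (intro card_UN_disjoint[symmetric]) (auto simp: cut_class_def)
  also have "R * real (card (\<Union>k\<in>I. cut_class V d W (k + 2 * j))) \<le> R * real (card ?\<G>)"
    using R0 finite_realizations[OF V, of d]
    by (intro mult_left_mono of_nat_mono card_mono) (auto simp: cut_class_def)
  also have "\<dots> \<le> (t / 4) ^ j * real (card ?\<G>)" using R by (intro mult_right_mono) auto
  also have "(t / 4) ^ j = (t / 4) powr real j" using t by (simp add: powr_realpow)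
  also have "\<dots> * real (card ?\<G>) \<le> (t / 4) powr (K / 2) * real (card ?\<G>)"
    using t jK by (intro mult_right_mono powr_mono') auto
  finally show ?thesis .
qed

subsection \<open>The union bound\<close>

lemma power_div_fact_le_exp:
  assumes "0 \<le> (x :: real)"
  shows "x ^ n / fact n \<le> exp x"
proof -
  have "(\<Sum>k\<in>{n}. x ^ k /\<^sub>R fact k) \<le> (\<Sum>k. x ^ k /\<^sub>R fact k)"
    using assms by (intro sum_le_suminf summable_exp_generic) auto
  then show ?thesis by (simp add: exp_def divide_inverse mult.commute)
qed

text \<open>\<open>k ^ k / fact k\<close> is a single term of the series of
  \<open>exp k\<close>.\<close>

lemma binomial_le_exp_power:
  assumes "0 < k"
  shows "real (n choose k) \<le> (exp 1 * real n / real k) ^ k"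
proof -
  have "real (n choose k) * fact k \<le> real n ^ k"
    using binomial_fact_pow[of n k] by (metis of_nat_fact of_nat_le_iff of_nat_mult of_nat_power)
  then have "real (n choose k) \<le> real n ^ k / fact k" by (simp add: field_simps)
  also have "\<dots> = (real n / real k) ^ k * (real k ^ k / fact k)"
    using assms by (simp add: power_divide)
  also have "\<dots> \<le> (real n / real k) ^ k * exp (real k)"
    by (intro mult_left_mono power_div_fact_le_exp) auto
  also have "\<dots> = (exp 1 * real n / real k) ^ k"
    by (simp add: power_divide power_mult_distrib flip: exp_of_nat_mult)
  finally show ?thesis .
qed

text \<open>Half of the exponent \<open>p * w\<close> pays for the choice of the set: the binomial
  is at most \<open>(exp 1 / t) ^ w\<close>, and as \<open>exp 1 / t \<ge> 1\<close> and
  \<open>p \<ge> 2\<close> the exponent may grow to \<open>p * w / 2\<close>. What remains is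
  \<open>exp 1 / t * (t / 4)\<^sup>2\<close> as base.\<close>

lemma binomial_times_powr_le:
  fixes t p :: real
  assumes w: "0 < w" and t: "0 < t" "t \<le> 1" and nt: "real n * t \<le> real w" and p: "2 \<le> p"
  shows "real (n choose w) * (t / 4) powr (p * real w) \<le> (exp 1 / 16 * t) powr (p * real w / 2)"
proof -
  have "real n / real w \<le> 1 / t" using nt w t by (simp add: field_simps)
  then have "exp 1 * real n / real w \<le> exp 1 / t"
    using mult_left_mono[of "real n / real w" "1 / t" "exp 1"] by simp
  then have "(exp 1 * real n / real w) ^ w \<le> (exp 1 / t) ^ w" by (intro power_mono) auto
  with binomial_le_exp_power[OF w] have "real (n choose w) \<le> (exp 1 / t) ^ w" by (rule order_trans)
  also have "\<dots> = (exp 1 / t) powr real w" using t by (simp add: powr_realpow)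
  also have "\<dots> \<le> (exp 1 / t) powr (p * real w / 2)"
  proof (rule powr_mono)
    show "real w \<le> p * real w / 2" using mult_right_mono[OF p, of "real w"] by simp
    show "1 \<le> exp 1 / t" using t exp_ge_add_one_self[of 1] by (simp add: field_simps)
  qed
  finally have n: "real (n choose w) \<le> (exp 1 / t) powr (p * real w / 2)" .
  have "(t / 4) powr (p * real w) = ((t / 4)\<^sup>2) powr (p * real w / 2)"
    using t powr_powr[of "t / 4" 2 "p * real w / 2"] by simp
  then have "real (n choose w) * (t / 4) powr (p * real w)
      \<le> (exp 1 / t) powr (p * real w / 2) * ((t / 4)\<^sup>2) powr (p * real w / 2)"
    using mult_right_mono[OF n] by simp
  also have "(exp 1 / t) powr (p * real w / 2) * ((t / 4)\<^sup>2) powr (p * real w / 2) =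
      (exp 1 / t * (t / 4)\<^sup>2) powr (p * real w / 2)"
    using t by (subst powr_mult[symmetric]) auto
  also have "exp 1 / t * (t / 4)\<^sup>2 = exp 1 / 16 * t" using t by (simp add: power2_eq_square)
  finally show ?thesis .
qed

text \<open>The function \<open>w \<mapsto> w ln (c w)\<close> is convex, with slope at most \<open>ln (1 / 3)\<close> as long as \<open>c w \<le> e / 32\<close>.\<close>

lemma powr_decay:
  fixes t p v w :: real
  assumes v: "0 < v" "v \<le> w" and t: "0 < t" "t \<le> 1 / 2" and p: "2 \<le> p"
  shows "(exp 1 / 16 * t) powr (p * w / 2) \<le>
    (exp 1 / 16 * (t * v / w)) powr (p * v / 2) * (1 / 3) powr (w - v)"
proof -
  define a where "a = exp 1 / 16 * t"
  define L where "L = ln (1 / 3 :: real)"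
  have a0: "a > 0" using t by (simp add: a_def)
  have w0: "w > 0" using v by linarith
  \<comment> \<open>The left side is the slope at \<open>u = w\<close> of
    \<open>u * ln (a * u / w)\<close>. Since \<open>exp 1 \<le> 3\<close>, \<open>exp 1 * a\<close>
    is at most 9/32.\<close>
  have "1 + ln a \<le> L"
  proof -
    have "exp 1 * a \<le> 3 * (3 / 16 * (1 / 2))"
      unfolding a_def using exp_le t by (intro mult_mono divide_right_mono) auto
    then have "exp 1 * a \<le> 1 / 3" by simp
    then have "ln (exp 1 * a) \<le> L" unfolding L_def using a0 by (intro ln_mono) auto
    then show ?thesis using a0 by (simp add: ln_mult)
  qed
  then have 1: "(w - v) * (1 + ln a) \<le> (w - v) * L" using v by (intro mult_left_mono) auto
  \<comment> \<open>\<open>ln z \<le> z - 1\<close> at \<open>z = w / v\<close> takes the place of a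
    convexity argument.\<close>
  have "v * ln (w / v) \<le> v * (w / v - 1)" using v w0 by (intro mult_left_mono ln_le_minus_one) auto
  also have "\<dots> = w - v" using v by (simp add: field_simps)
  finally have 2: "v * ln (w / v) \<le> w - v" .
  have ln_av: "ln (a * v / w) = ln a - ln (w / v)" using a0 v w0 by (simp add: ln_mult ln_div)
  have "w * ln a \<le> v * ln (a * v / w) + (w - v) * L"
    unfolding ln_av using 1 2 by (simp add: algebra_simps)
  then have "p / 2 * (w * ln a) \<le> p / 2 * (v * ln (a * v / w) + (w - v) * L)"
    using p by (intro mult_left_mono) auto
  \<comment> \<open>\<open>L\<close> is negative and \<open>p / 2 \<ge> 1\<close>, so replacing the
    factor \<open>p / 2\<close> by 1 weakens the bound.\<close>
  moreover have "p / 2 * ((w - v) * L) \<le> 1 * ((w - v) * L)"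
    using p v unfolding L_def by (intro mult_right_mono_neg mult_nonneg_nonpos) auto
  ultimately have "p * w / 2 * ln a \<le> p * v / 2 * ln (a * v / w) + (w - v) * L"
    by (simp add: algebra_simps)
  then have "exp (p * w / 2 * ln a) \<le> exp (p * v / 2 * ln (a * v / w)) * exp ((w - v) * L)"
    by (simp flip: exp_add)
  then have "a powr (p * w / 2) \<le> (a * v / w) powr (p * v / 2) * (1 / 3) powr (w - v)"
    using a0 v w0 by (simp add: powr_def L_def)
  then show ?thesis by (simp add: a_def mult.assoc)
qed

text \<open>All \<open>w\<close> exceed \<open>m\<close>, the ceiling of \<open>v\<close>, so the
  terms are dominated by distinct terms of 1/3 + 1/9 + ..., whose sum is 1/2.\<close>

lemma sum_powr_third_le_one:
  fixes v :: real
  assumes "finite S" "\<And>w. w \<in> S \<Longrightarrow> v + 1 \<le> real w" "0 \<le> v"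
  shows "(\<Sum>w\<in>S. (1 / 3) powr (real w - v)) \<le> (1 :: real)"
proof -
  define m where "m = nat \<lceil>v\<rceil>"
  have m: "v \<le> real m" "real m < v + 1"
    using ceiling_correct[of v] assms(3) unfolding m_def by linarith+
  have Suc: "Suc m \<le> w" if "w \<in> S" for w
    using assms(2)[OF that] m by linarith
  have "(\<Sum>w\<in>S. (1 / 3) powr (real w - v)) \<le> (\<Sum>w\<in>S. (1 / 3 :: real) ^ Suc (w - Suc m))"
  proof (rule sum_mono)
    fix w assume w: "w \<in> S"
    have "real w - real m = real (Suc (w - Suc m))" using Suc[OF w] by simp
    then have "real (Suc (w - Suc m)) \<le> real w - v" using m by linarith
    then have "(1 / 3 :: real) powr (real w - v) \<le> (1 / 3) powr real (Suc (w - Suc m))"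
      by (intro powr_mono') auto
    also have "\<dots> = (1 / 3) ^ Suc (w - Suc m)" by (rule powr_realpow) simp
    finally show "(1 / 3) powr (real w - v) \<le> (1 / 3 :: real) ^ Suc (w - Suc m)" .
  qed
  also have "\<dots> = (\<Sum>i\<in>(\<lambda>w. w - Suc m) ` S. (1 / 3) ^ Suc i)"
    using Suc by (subst sum.reindex) (auto simp: inj_on_def dest: eq_diff_iff)
  also have "\<dots> \<le> (\<Sum>i. (1 / 3 :: real) ^ Suc i)"
    using assms(1) by (intro sum_le_suminf) (auto intro!: summable_mult summable_geometric)
  also have "\<dots> = 1 / 3 * (\<Sum>i. (1 / 3 :: real) ^ i)"
    by (simp only: power_Suc) (rule suminf_mult, simp)
  also have "\<dots> \<le> 1" by (subst suminf_geometric) auto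
  finally show ?thesis .
qed

lemma sum_over_subsets_by_card:
  fixes f :: "nat \<Rightarrow> real"
  assumes V: "finite V" and \<W>: "\<W> \<subseteq> Pow V" and f: "\<And>w. 0 \<le> f w"
  shows "(\<Sum>W\<in>\<W>. f (card W)) \<le> (\<Sum>w\<in>card ` \<W>. real (card V choose w) * f w)"
proof -
  have fin: "finite \<W>" using \<W> V finite_subset by blast
  have "(\<Sum>W\<in>\<W>. f (card W)) = (\<Sum>w\<in>card ` \<W>. \<Sum>W\<in>{W \<in> \<W>. card W = w}. f (card W))"
    by (rule sum.image_gen[OF fin])
  also have "\<dots> = (\<Sum>w\<in>card ` \<W>. real (card {W \<in> \<W>. card W = w}) * f w)" by simp
  also have "\<dots> \<le> (\<Sum>w\<in>card ` \<W>. real (card V choose w) * f w)"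
  proof (intro sum_mono mult_right_mono f)
    fix w
    have "card {W \<in> \<W>. card W = w} \<le> card {W. W \<subseteq> V \<and> card W = w}"
      using V \<W> by (intro card_mono) auto
    then show "real (card {W \<in> \<W>. card W = w}) \<le> real (card V choose w)"
      by (simp add: n_subsets[OF V])
  qed
  finally show ?thesis .
qed

text \<open>Union bound grouped by size: the sets of size \<open>w\<close> contribute at most the
  claimed probability times \<open>(1 / 3) powr (w - v)\<close>, and these factors sum to at most
  1.\<close>

lemma card_poorly_expanding_le:
  fixes C \<alpha> :: real
  assumes V: "finite V"
    and deg: "\<And>v. v \<in> V \<Longrightarrow> \<delta> \<le> d v" "\<And>v. v \<in> V \<Longrightarrow> d v \<le> \<Delta>"
    and C: "C > 0" and \<alpha>: "\<alpha> = 1 / (6 + 8 * C)"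
    and \<delta>: "24 + 32 * C \<le> real \<delta>"
    and \<Delta>: "(real \<Delta>)\<^sup>2 \<le> C * real (\<Sum>v\<in>V. d v)"
  defines "\<W> \<equiv> {W. W \<subseteq> V \<and> 2 * (\<Sum>v\<in>W. d v) \<le> (\<Sum>v\<in>V. d v) \<and> 5 / 6 * real \<delta> + 1 \<le> real (card W)}"
  shows "real (card {E \<in> realizations V d.
        \<exists>W\<in>\<W>. real (card (edge_boundary V E W)) < \<alpha> * real \<delta> * real (card W)})
    \<le> ((real \<delta>)\<^sup>2 / (5 * real (\<Sum>v\<in>V. d v))) powr (5 / 26 * \<alpha> * (real \<delta>)\<^sup>2)
        * real (card (realizations V d))"
proof -
  define M where "M = real (\<Sum>v\<in>V. d v)"
  define p where "p = \<alpha> * real \<delta> / 2"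
  define v where "v = 5 / 6 * real \<delta>"
  define t where "t = (\<lambda>w::nat. real \<delta> * real w / M)"
  define B where "B = (real \<delta>)\<^sup>2 / (5 * M)"
  define f where "f = (\<lambda>w::nat. (t w / 4) powr (p * real w))"
  let ?\<G> = "realizations V d"
  let ?bad = "\<lambda>W. {E \<in> ?\<G>. real (card (edge_boundary V E W)) < \<alpha> * real \<delta> * real (card W)}"
  have finW: "finite \<W>" using V by (auto simp: \<W>_def)
  have a0: "0 < \<alpha>" using C by (simp add: \<alpha>)
  \<comment> \<open>\<open>24 + 32 * C\<close> is \<open>4 * (6 + 8 * C)\<close>, so
    \<open>\<alpha> * \<delta> \<ge> 4\<close>.\<close>
  have p2: "2 \<le> p" using \<delta> C by (simp add: p_def \<alpha> field_simps)
  have d24: "24 \<le> real \<delta>" using \<delta> C by simp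
  have v0: "0 < v" using d24 by (simp add: v_def)
  have w: "0 < w \<and> v + 1 \<le> real w \<and> 0 < t w \<and> t w \<le> 1 / 2 \<and> 0 < M" if "w \<in> card ` \<W>" for w
  proof -
    obtain W where W: "W \<subseteq> V" "2 * (\<Sum>v\<in>W. d v) \<le> (\<Sum>v\<in>V. d v)" "v + 1 \<le> real w" "w = card W"
      using \<open>w \<in> card ` \<W>\<close> unfolding \<W>_def v_def by blast
    have w0: "0 < w" using W(3) v0 by (cases w) auto
    have "card W * \<delta> \<le> (\<Sum>v\<in>W. d v)"
      using sum_bounded_below[of W \<delta> d] deg W by auto
    then have "2 * (card W * \<delta>) \<le> (\<Sum>v\<in>V. d v)" using W by linarith
    then have "real (2 * (card W * \<delta>)) \<le> M" unfolding M_def by (simp only: of_nat_le_iff)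
    then have le: "2 * (real \<delta> * real w) \<le> M" using W by (simp add: mult.commute)
    moreover have "0 < real \<delta> * real w" using w0 d24 by simp
    ultimately have M0: "0 < M" by linarith
    then have "t w \<le> 1 / 2" using le by (simp add: t_def divide_le_eq)
    moreover have "0 < t w" using M0 w0 d24 by (simp add: t_def)
    ultimately show ?thesis using w0 W(3) M0 by blast
  qed
  have bad: "real (card (?bad W)) \<le> f (card W) * real (card ?\<G>)" if W: "W \<in> \<W>" for W
  proof -
    have "21 \<le> real (card W)" using W d24 by (simp add: \<W>_def)
    then have "2 * 21 \<le> p * real (card W)" using p2 by (intro mult_mono) auto
    then have "30 \<le> \<alpha> * real \<delta> * real (card W)" by (simp add: p_def)
    then have "real (card (?bad W)) \<le>
        (t (card W) / 4) powr (\<alpha> * real \<delta> * real (card W) / 2) * real (card ?\<G>)"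
      unfolding t_def M_def using W V
      by (intro card_small_cut_le[where d = d and \<Delta> = \<Delta>, OF _ _ deg _ C \<alpha> \<Delta>]) (auto simp: \<W>_def)
    then show ?thesis by (simp add: f_def p_def)
  qed
  have class_bound: "real (card V choose w) * f w \<le> B powr (5 / 26 * \<alpha> * (real \<delta>)\<^sup>2) * (1 / 3) powr (real w - v)"
    if "w \<in> card ` \<W>" for w
  proof -
    note w = w[OF that]
    have "card V * \<delta> \<le> (\<Sum>v\<in>V. d v)" using sum_bounded_below[of V \<delta> d] deg by auto
    then have "real (card V) * real \<delta> \<le> M" unfolding M_def by (metis of_nat_le_iff of_nat_mult)
    then have "real (card V) * real \<delta> * real w \<le> M * real w" by (intro mult_right_mono) auto
    then have nt: "real (card V) * t w \<le> real w" using w by (simp add: t_def field_simps)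
    \<comment> \<open>This quantity no longer depends on \<open>w\<close>: the size enters the final
      bound only through the geometric factor.\<close>
    have tv: "t w * v / real w = 5 / 6 * (5 * B)"
      using w by (simp add: t_def v_def B_def power2_eq_square)
    have "t w * v / real w \<le> t w" using w v0 by (simp add: divide_le_eq mult_left_mono)
    then have B1: "B \<le> 1" using w unfolding tv by linarith
    have B0: "0 \<le> B" using w by (simp add: B_def)
    have "real (card V choose w) * f w \<le> (exp 1 / 16 * t w) powr (p * real w / 2)"
      unfolding f_def using w nt p2 by (intro binomial_times_powr_le) auto
    also have "\<dots> \<le> (exp 1 / 16 * (t w * v / real w)) powr (p * v / 2) * (1 / 3) powr (real w - v)"
      using w v0 p2 by (intro powr_decay) auto
    also have "\<dots> \<le> B powr (5 / 26 * \<alpha> * (real \<delta>)\<^sup>2) * (1 / 3) powr (real w - v)"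
    proof (rule mult_right_mono)
      \<comment> \<open>The constant is 3/16 * 25/6 = 25/32, below 1.\<close>
      have "exp 1 / 16 * (t w * v / real w) \<le> 3 / 16 * (5 / 6 * (5 * B))"
        unfolding tv using exp_le B0 by (intro mult_right_mono) auto
      also have "\<dots> \<le> B" using B0 by simp
      finally have "(exp 1 / 16 * (t w * v / real w)) powr (p * v / 2) \<le> B powr (p * v / 2)"
        using p2 v0 w by (intro powr_mono2) auto
      also have "\<dots> \<le> B powr (5 / 26 * \<alpha> * (real \<delta>)\<^sup>2)"
      proof (rule powr_mono'[OF _ B0 B1])
        \<comment> \<open>The argument yields the exponent
          \<open>p * v / 2 = 5 / 24 * \<alpha> * \<delta>\<^sup>2\<close>; since
          \<open>B \<le> 1\<close> it may be lowered to the stated one.\<close>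
        have "5 / 26 * (\<alpha> * (real \<delta>)\<^sup>2) \<le> 5 / 24 * (\<alpha> * (real \<delta>)\<^sup>2)"
          using a0 by (intro mult_right_mono) auto
        then show "5 / 26 * \<alpha> * (real \<delta>)\<^sup>2 \<le> p * v / 2"
          by (simp add: p_def v_def power2_eq_square)
      qed
      finally show "(exp 1 / 16 * (t w * v / real w)) powr (p * v / 2) \<le> B powr (5 / 26 * \<alpha> * (real \<delta>)\<^sup>2)" .
    qed simp
    finally show ?thesis .
  qed
  have "{E \<in> ?\<G>. \<exists>W\<in>\<W>. real (card (edge_boundary V E W)) < \<alpha> * real \<delta> * real (card W)} = (\<Union>W\<in>\<W>. ?bad W)"
    by auto
  then have "real (card {E \<in> ?\<G>. \<exists>W\<in>\<W>. real (card (edge_boundary V E W)) < \<alpha> * real \<delta> * real (card W)})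
      \<le> real (\<Sum>W\<in>\<W>. card (?bad W))"
    using card_UN_le[OF finW, of ?bad] by (simp only: of_nat_le_iff)
  also have "\<dots> = (\<Sum>W\<in>\<W>. real (card (?bad W)))" by (rule of_nat_sum)
  also have "\<dots> \<le> (\<Sum>W\<in>\<W>. f (card W) * real (card ?\<G>))" by (rule sum_mono[OF bad])
  also have "\<dots> = (\<Sum>W\<in>\<W>. f (card W)) * real (card ?\<G>)" by (rule sum_distrib_right[symmetric])
  also have "\<dots> \<le> B powr (5 / 26 * \<alpha> * (real \<delta>)\<^sup>2) * real (card ?\<G>)"
  proof (rule mult_right_mono)
    have "(\<Sum>W\<in>\<W>. f (card W)) \<le> (\<Sum>w\<in>card ` \<W>. real (card V choose w) * f w)"
      using V by (rule sum_over_subsets_by_card) (auto simp: \<W>_def f_def)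
    also have "\<dots> \<le> (\<Sum>w\<in>card ` \<W>. B powr (5 / 26 * \<alpha> * (real \<delta>)\<^sup>2) * (1 / 3) powr (real w - v))"
      by (rule sum_mono[OF class_bound])
    also have "\<dots> = B powr (5 / 26 * \<alpha> * (real \<delta>)\<^sup>2) * (\<Sum>w\<in>card ` \<W>. (1 / 3) powr (real w - v))"
      by (rule sum_distrib_left[symmetric])
    also have "\<dots> \<le> B powr (5 / 26 * \<alpha> * (real \<delta>)\<^sup>2) * 1"
      using finW w v0 by (intro mult_left_mono sum_powr_third_le_one) auto
    finally show "(\<Sum>W\<in>\<W>. f (card W)) \<le> B powr (5 / 26 * \<alpha> * (real \<delta>)\<^sup>2)" by simp
  qed simp
  finally show ?thesis unfolding B_def M_def .
qed

section \<open>From a small isoperimetric number to a poorly expanding set, and the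
  conclusion\<close>

lemma less_isoperimetric_numberD:
  assumes V: "finite V" "2 \<le> card V" and less: "isoperimetric_number V E < c"
  obtains U where "U \<subseteq> V" "2 * card U \<le> card V" "real (card (edge_boundary V E U)) < c * real (card U)"
proof -
  define \<U> where "\<U> = {U. U \<subseteq> V \<and> 1 \<le> card U \<and> real (card U) \<le> real (card V) / 2}"
  let ?q = "\<lambda>U. real (card (edge_boundary V E U)) / real (card U)"
  have iso: "isoperimetric_number V E = Min (?q ` \<U>)"
    unfolding isoperimetric_number_def \<U>_def by (simp add: setcompr_eq_image)
  have "finite \<U>" using V by (auto simp: \<U>_def)
  moreover have "\<U> \<noteq> {}"
  proof -
    obtain v where "v \<in> V" using V by fastforce
    then have "{v} \<in> \<U>" using V by (auto simp: \<U>_def)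
    then show ?thesis by blast
  qed
  ultimately have "Min (?q ` \<U>) \<in> ?q ` \<U>" by (intro Min_in) auto
  then obtain U where U: "U \<in> \<U>" "?q U < c" using less iso by auto
  show ?thesis
  proof (rule that)
    show "U \<subseteq> V" using U by (simp add: \<U>_def)
    have "real (2 * card U) \<le> real (card V)" using U by (simp add: \<U>_def)
    then show "2 * card U \<le> card V" by (simp only: of_nat_le_iff)
    have "0 < real (card U)" using U by (simp add: \<U>_def)
    then show "real (card (edge_boundary V E U)) < c * real (card U)"
      using U(2) by (simp add: divide_less_eq)
  qed
qed

text \<open>If \<open>U\<close> carries more than half of the degree sum, its complement does not,
  has the same boundary and at least as many vertices, so it expands no better. The lower bound on
  the size comes from \<open>c = a * \<delta> \<le> \<delta> / 6\<close> in
  \<open>card_ge_of_small_boundary\<close>.\<close>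

lemma exists_poorly_expanding_set:
  assumes E: "E \<in> realizations V d" and V: "2 \<le> card V"
    and deg: "\<And>v. v \<in> V \<Longrightarrow> \<delta> \<le> d v"
    and a: "0 \<le> a" "6 * a \<le> 1"
    and less: "isoperimetric_number V E < a * real \<delta>"
  shows "\<exists>W\<subseteq>V. 2 * (\<Sum>v\<in>W. d v) \<le> (\<Sum>v\<in>V. d v) \<and> 5 / 6 * real \<delta> + 1 \<le> real (card W) \<and>
    real (card (edge_boundary V E W)) < a * real \<delta> * real (card W)"
proof -
  have G: "simple_graph V E" and dE: "\<And>v. v \<in> V \<Longrightarrow> vertex_degree E v = d v"
    using E by (auto simp: realizations_def)
  have finV: "finite V" using G by (simp add: simple_graph_def)
  obtain U where U: "U \<subseteq> V" "2 * card U \<le> card V" "real (card (edge_boundary V E U)) < a * real \<delta> * real (card U)"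
    using less_isoperimetric_numberD[OF finV V less] by blast
  have "\<exists>W\<subseteq>V. 2 * (\<Sum>v\<in>W. d v) \<le> (\<Sum>v\<in>V. d v) \<and>
    real (card (edge_boundary V E W)) < a * real \<delta> * real (card W)"
  proof (cases "2 * (\<Sum>v\<in>U. d v) \<le> (\<Sum>v\<in>V. d v)")
    case False
    have "(\<Sum>v\<in>V - U. d v) + (\<Sum>v\<in>U. d v) = (\<Sum>v\<in>V. d v)"
      using sum.subset_diff[OF U(1) finV, of d] by simp
    then have "2 * (\<Sum>v\<in>V - U. d v) \<le> (\<Sum>v\<in>V. d v)" using False by linarith
    moreover have "card U \<le> card (V - U)"
      using U finV by (simp add: card_Diff_subset finite_subset)
    then have "a * real \<delta> * real (card U) \<le> a * real \<delta> * real (card (V - U))"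
      using a by (intro mult_left_mono) auto
    then have "real (card (edge_boundary V E (V - U))) < a * real \<delta> * real (card (V - U))"
      using U edge_boundary_complement[OF U(1), of E] by simp
    ultimately show ?thesis by blast
  qed (use U in blast)
  then obtain W where W: "W \<subseteq> V" "2 * (\<Sum>v\<in>W. d v) \<le> (\<Sum>v\<in>V. d v)"
    "real (card (edge_boundary V E W)) < a * real \<delta> * real (card W)" by blast
  have "real \<delta> + 1 - a * real \<delta> < real (card W)"
    using card_ge_of_small_boundary[OF G W(1) _ W(3)] deg dE by simp
  moreover have "a * real \<delta> \<le> 1 / 6 * real \<delta>" using a by (intro mult_right_mono) auto
  ultimately have "5 / 6 * real \<delta> + 1 \<le> real (card W)" by simp
  with W show ?thesis by blast
qed

theorem theorem4p3:
  fixes n :: nat and d :: "nat \<Rightarrow> nat" and C \<alpha> :: real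
  assumes "n \<ge> 1"
    and "is_degree_sequence n d"
    and "C > 0"
    and "real (min_degree n d) \<ge> 24 + 32 * C"
    and "(real (max_degree n d))^2 \<le> C * avg_degree n d * real n"
    and "\<alpha> = 1 / (6 + 8 * C)"
  shows "measure_pmf.prob (random_graph n d)
           {G. isoperimetric_number {1..n} G \<ge> \<alpha> * real (min_degree n d)}
         \<ge> 1 - ((real (min_degree n d))^2 / (5 * avg_degree n d * real n))
                 powr (5 / 26 * \<alpha> * (real (min_degree n d))^2)"
proof -
  define V where "V = {1..n}"
  define \<delta> where "\<delta> = min_degree n d"
  define \<Delta> where "\<Delta> = max_degree n d"
  define \<G> where "\<G> = realizations V d"
  define A where "A = {G. isoperimetric_number V G \<ge> \<alpha> * real \<delta>}"
  define \<W> where "\<W> = {W. W \<subseteq> V \<and> 2 * (\<Sum>v\<in>W. d v) \<le> (\<Sum>v\<in>V. d v) \<and> 5 / 6 * real \<delta> + 1 \<le> real (card W)}"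
  define \<B> where "\<B> = {E \<in> \<G>. \<exists>W\<in>\<W>. real (card (edge_boundary V E W)) < \<alpha> * real \<delta> * real (card W)}"
  define b where "b = ((real \<delta>)\<^sup>2 / (5 * real (\<Sum>v\<in>V. d v))) powr (5 / 26 * \<alpha> * (real \<delta>)\<^sup>2)"
  have finV: "finite V" by (simp add: V_def)
  have graphs: "graphs_with_degrees n d = \<G>"
    by (simp add: graphs_with_degrees_def realizations_def \<G>_def V_def)
  have fin: "finite \<G>" unfolding \<G>_def by (rule finite_realizations[OF finV])
  have ne: "\<G> \<noteq> {}" using assms(2) graphs by (simp add: is_degree_sequence_def)
  have M: "avg_degree n d * real n = real (\<Sum>v\<in>V. d v)"
    using assms(1) by (simp add: avg_degree_def V_def)
  have deg: "\<delta> \<le> d v" "d v \<le> \<Delta>" if "v \<in> V" for v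
    using that by (auto simp: \<delta>_def \<Delta>_def min_degree_def max_degree_def V_def)
  have a: "0 \<le> \<alpha>" "6 * \<alpha> \<le> 1" using assms(3) by (auto simp: assms(6) field_simps)
  \<comment> \<open>For \<open>n = 1\<close> the minimum would range over an empty set; a lone
    vertex has degree 0, contradicting the lower bound on the minimum degree.\<close>
  have V2: "2 \<le> card V"
  proof (rule ccontr)
    assume "\<not> 2 \<le> card V"
    then have V1: "V = {1}" using assms(1) by (auto simp: V_def)
    obtain E where "E \<in> \<G>" using ne by blast
    then have "simple_graph V E" "vertex_degree E 1 = d 1"
      by (auto simp: \<G>_def realizations_def V1)
    moreover have "{y \<in> V. {1, y} \<in> E} = {}"
      using simple_graph_edgeD[OF \<open>simple_graph V E\<close>, of 1 1] by (auto simp: V1)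
    ultimately have "d 1 = 0" using vertex_degree_eq_card_neighbours[of V E 1] by (metis card.empty)
    then show False using deg[of 1] assms(3,4) by (simp add: V1 flip: \<delta>_def)
  qed
  have "\<G> - A \<subseteq> \<B>"
  proof
    fix E assume E: "E \<in> \<G> - A"
    then have "isoperimetric_number V E < \<alpha> * real \<delta>" by (simp add: A_def)
    from exists_poorly_expanding_set[where d = d, OF _ V2 deg(1) a this] E
    show "E \<in> \<B>" unfolding \<G>_def \<B>_def \<W>_def by blast
  qed
  then have "real (card (\<G> - A)) \<le> real (card \<B>)"
    using fin by (intro of_nat_mono card_mono) (auto simp: \<B>_def)
  also have "\<dots> \<le> b * real (card \<G>)"
    unfolding b_def \<G>_def \<B>_def \<W>_def
  proof (rule card_poorly_expanding_le[where d = d and \<Delta> = \<Delta>, OF finV deg(1) deg(2) assms(3) assms(6)])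
    show "24 + 32 * C \<le> real \<delta>" using assms(4) by (simp add: \<delta>_def)
    show "(real \<Delta>)\<^sup>2 \<le> C * real (\<Sum>v\<in>V. d v)"
      using assms(5) unfolding M[symmetric] \<Delta>_def by (simp add: mult.assoc)
  qed auto
  finally have bad: "real (card (\<G> - A)) \<le> b * real (card \<G>)" .
  have "card (\<G> \<inter> A) + card (\<G> - A) = card \<G>"
    using fin by (rule card_Int_Diff[symmetric])
  then have "real (card (\<G> \<inter> A)) + real (card (\<G> - A)) = real (card \<G>)"
    by (metis of_nat_add)
  with bad have "(1 - b) * real (card \<G>) \<le> real (card (\<G> \<inter> A))"
    by (simp add: algebra_simps)
  moreover have "0 < real (card \<G>)" using fin ne by (simp add: card_gt_0_iff)
  ultimately have "1 - b \<le> real (card (\<G> \<inter> A)) / real (card \<G>)"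
    by (simp add: le_divide_eq)
  also have "\<dots> = measure_pmf.prob (random_graph n d) A"
    unfolding random_graph_def graphs by (rule measure_pmf_of_set[OF ne fin, symmetric])
  finally show ?thesis
    unfolding b_def M[symmetric] unfolding A_def \<delta>_def V_def by (simp only: mult.assoc)
qed

end
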